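(* For all integers $k\ge 1$ and $r\ge 1$ there is a graph $G^k_r$ with $\mathrm{tw}(G^k_r)=k$ such that $\mathrm{wcol}_r(G^k_r)=\binom{r+k}{k}$; in fact, $\mathrm{wcol}_{r'}(G^k_r)=\binom{r'+k}{k}$ for all $1\le r'\le r$.
   Context: All graphs are finite and simple; $\mathrm{tw}$ denotes treewidth. A linear order on $V(G)$ is an injective map $L\colon V(G)\to\mathbb{N}$; $\Pi(G)$ is the set of all such orders. The length of a path is its number of edges. A vertex $u$ is weakly $r$-reachable from $v$ with respect to $L$ if there is a path $P$ of length $0\le\ell\le r$ from $v$ to $u$ with $L(u)\le L(w)$ for all $w\in V(P)$; $\mathrm{WReach}_r[G,L,v]$ is the set of such $u$. The weak $r$-colouring number is $\mathrm{wcol}_r(G)=\min_{L\in\Pi(G)}\max_{v\in V(G)}|\mathrm{WReach}_r[G,L,v]|$. *)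

theory Defs
  imports "Graph_Theory.Graph_Theory"
begin

text \<open>
  A finite simple graph is a \<^locale>\<open>pair_graph\<close>: an edge between u and v is represented by
  the two arcs (u, v) and (v, u), and there are no loops.
\<close>

text \<open>
  The library's \<^const>\<open>tree\<close> is not usable for such graphs: it is meant for digraphs, where the
  two arcs of a single edge already form a cycle. Cycles are therefore given by paths on
  at least three vertices whose ends are adjacent.
\<close>

definition undirected_tree :: "'t pair_pre_digraph \<Rightarrow> bool" where
  "undirected_tree T \<longleftrightarrow>
     pair_graph T \<and> Digraph_Component.connected (with_proj T) \<and>
     \<not> (\<exists>c. vpath c (with_proj T) \<and> 3 \<le> length c \<and> (last c, hd c) \<in> parcs T)"

text \<open>
  The predicate \<^const>\<open>Digraph_Component.connected\<close> includes that the vertex set is nonempty.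
\<close>

definition tree_decomposition ::
  "'a pair_pre_digraph \<Rightarrow> 't pair_pre_digraph \<Rightarrow> ('t \<Rightarrow> 'a set) \<Rightarrow> bool" where
  "tree_decomposition G T B \<longleftrightarrow>
     undirected_tree T \<and>
     (\<Union>t\<in>pverts T. B t) = pverts G \<and>
     (\<forall>(u, v)\<in>parcs G. \<exists>t\<in>pverts T. u \<in> B t \<and> v \<in> B t) \<and>
     (\<forall>v\<in>pverts G. Digraph_Component.connected (with_proj T \<restriction> {t \<in> pverts T. v \<in> B t}))"

definition decomposition_width :: "'t pair_pre_digraph \<Rightarrow> ('t \<Rightarrow> 'a set) \<Rightarrow> nat" where
  "decomposition_width T B = (MAX t\<in>pverts T. card (B t)) - 1"

text \<open>
  Taking the nodes of the decomposition trees to be natural numbers is no restriction, since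
  the trees are finite. Every finite graph has a decomposition with a single bag, so the
  infimum is a minimum. Subtraction on \<^typ>\<open>nat\<close> truncates, so the null graph has treewidth 0
  here; in all other cases some bag is nonempty and nothing is truncated.
\<close>

definition treewidth :: "'a pair_pre_digraph \<Rightarrow> nat" where
  "treewidth G =
     Inf {decomposition_width T B | (T :: nat pair_pre_digraph) B. tree_decomposition G T B}"

text \<open>
  A linear order on the vertices is an injective map into the natural numbers. Its values
  outside the vertex set are irrelevant.
\<close>

definition linear_orders :: "'a pair_pre_digraph \<Rightarrow> ('a \<Rightarrow> nat) set" where
  "linear_orders G = {L. inj_on L (pverts G)}"

definition WReach :: "nat \<Rightarrow> 'a pair_pre_digraph \<Rightarrow> ('a \<Rightarrow> nat) \<Rightarrow> 'a \<Rightarrow> 'a set" where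
  "WReach r G L v =
     {u. \<exists>p. vpath p (with_proj G) \<and> hd p = v \<and> last p = u \<and> vwalk_length p \<le> r \<and>
             (\<forall>w\<in>set p. L u \<le> L w)}"

text \<open>
  The infimum of a nonempty set of natural numbers is its minimum. The value is meaningful
  for graphs with at least one vertex only.
\<close>

definition wcol :: "nat \<Rightarrow> 'a pair_pre_digraph \<Rightarrow> nat" where
  "wcol r G = (INF L\<in>linear_orders G. MAX v\<in>pverts G. card (WReach r G L v))"

end

theory Submission
  imports Defs
begin

text \<open>
  The graphs are partial \<open>k\<close>-trees on \<open>{..<n}\<close> in which the smaller neighbours of each vertex form
  a clique of size at most \<open>k\<close>. For the order given by the numbers themselves, a vertex
  weakly reachable from \<open>v\<close> is reached by a descending path. Let \<open>x\<close> be the smallest neighbour of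
  \<open>v\<close>. A descending path from \<open>v\<close> either stays above \<open>x\<close>, where all vertices concerned are adjacent
  to \<open>x\<close> and so have one smaller neighbour less, or it can be rerouted such that \<open>x\<close> is its second
  vertex. This gives Pascal's recurrence \<open>f(r + 1, k + 1) \<le> f(r + 1, k) + f(r, k + 1)\<close>.

  For the lower bound, the graph for \<open>(k + 1, r + 1)\<close> arises from that for \<open>(k + 1, r)\<close> by attaching
  to each vertex \<open>x\<close> many disjoint copies of the graph for \<open>(k, r + 1)\<close>, joined completely to \<open>x\<close>.
  This makes the recurrence an equality for every order. The graph contains a clique on \<open>k + 1\<close>
  vertices, which lies in a bag of any tree decomposition.
\<close>

section \<open>Weak reachability along a relation\<close>

text \<open>Only the adjacency relation enters, so paths can be carried over to supergraphs and
  along embeddings. A path with at most \<open>r\<close> edges is a list of length at most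
  \<open>Suc r\<close>.\<close>

definition wreach :: "('a \<Rightarrow> 'a \<Rightarrow> bool) \<Rightarrow> nat \<Rightarrow> ('a \<Rightarrow> nat) \<Rightarrow> 'a \<Rightarrow> 'a set" where
  "wreach E r L v =
     {u. \<exists>p. p \<noteq> [] \<and> distinct p \<and> successively E p \<and> hd p = v \<and> last p = u \<and>
             length p \<le> Suc r \<and> (\<forall>w\<in>set p. L u \<le> L w)}"

lemma vwalk_arcs_subset_iff: "set (vwalk_arcs p) \<subseteq> S \<longleftrightarrow> successively (\<lambda>a b. (a, b) \<in> S) p"
  by (induction p rule: vwalk_arcs.induct) auto

lemma vpath_with_proj_iff:
  "vpath p (with_proj G) \<longleftrightarrow>
     p \<noteq> [] \<and> distinct p \<and> set p \<subseteq> pverts G \<and> successively (\<lambda>a b. (a, b) \<in> parcs G) p"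
  by (auto simp: vpath_def vwalk_def vwalk_arcs_subset_iff)

lemma successively_set_subset:
  assumes "successively E p" "hd p \<in> S" "\<And>a b. E a b \<Longrightarrow> b \<in> S"
  shows "set p \<subseteq> S"
  using assms by (induction p) (auto simp: successively_Cons)

text \<open>Arcs end in vertices, so a path that starts in the graph never leaves it.\<close>

lemma WReach_eq_wreach:
  assumes "pair_wf_digraph G" "v \<in> pverts G"
  shows "WReach r G L v = wreach (\<lambda>a b. (a, b) \<in> parcs G) r L v"
proof -
  interpret pair_wf_digraph G by fact
  have "set p \<subseteq> pverts G" if "successively (\<lambda>a b. (a, b) \<in> parcs G) p" "hd p = v" for p
    using successively_set_subset[OF that(1)] that(2) assms(2) in_arcsD2 by metis
  then show ?thesis
    unfolding WReach_def wreach_def vpath_with_proj_iff by (auto simp: le_diff_conv)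
qed

lemma wreach_subset:
  assumes "v \<in> S" "\<And>a b. E a b \<Longrightarrow> b \<in> S"
  shows "wreach E r L v \<subseteq> S"
proof
  fix u assume "u \<in> wreach E r L v"
  then obtain p where "p \<noteq> []" "successively E p" "hd p = v" "last p = u"
    unfolding wreach_def by auto
  then show "u \<in> S"
    using successively_set_subset[of E p S] assms last_in_set by fastforce
qed

lemma wreach_self [simp]: "v \<in> wreach E r L v"
  unfolding wreach_def by (intro CollectI exI[of _ "[v]"]) auto

lemma wreach_image:
  assumes "inj f" "\<And>a b. E a b \<Longrightarrow> E' (f a) (f b)"
  shows "f ` wreach E r (L \<circ> f) v \<subseteq> wreach E' r L (f v)"
proof
  fix y assume "y \<in> f ` wreach E r (L \<circ> f) v"
  then obtain p where p: "p \<noteq> []" "distinct p" "successively E p" "hd p = v" "f (last p) = y"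
    "length p \<le> Suc r" "\<forall>w\<in>set p. L y \<le> L (f w)"
    unfolding wreach_def by auto
  then show "y \<in> wreach E' r L (f v)"
    unfolding wreach_def using assms
    by (intro CollectI exI[of _ "map f p"])
      (auto simp: distinct_map inj_on_def hd_map last_map successively_map
        intro: successively_mono)
qed

lemma wreach_mono:
  assumes "\<And>a b. E a b \<Longrightarrow> E' a b"
  shows "wreach E r L v \<subseteq> wreach E' r L v"
  using wreach_image[of id E E' r L v] assms by auto

text \<open>
  The minimum of the path from \<open>x\<close> has \<open>L\<close>-value at most that of \<open>x\<close>, hence prepending
  a larger vertex keeps it a minimum.
\<close>

lemma wreach_step:
  assumes "E v x" "L x < L v" "\<And>a b. E' a b \<Longrightarrow> E a b"
    "v \<notin> S" "x \<in> S" "\<And>a b. E' a b \<Longrightarrow> b \<in> S"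
  shows "wreach E' r L x \<subseteq> wreach E (Suc r) L v"
proof
  fix u assume "u \<in> wreach E' r L x"
  then obtain p where p: "p \<noteq> []" "distinct p" "successively E' p" "hd p = x" "last p = u"
    "length p \<le> Suc r" "\<forall>w\<in>set p. L u \<le> L w"
    unfolding wreach_def by auto
  \<comment> \<open>The set \<open>S\<close> holds the whole path but not \<open>v\<close>, so
    \<open>v # p\<close> is again free of repetitions.\<close>
  have "set p \<subseteq> S"
    using successively_set_subset p(3,4) assms(5,6) by metis
  moreover have "L u \<le> L v"
    using p(1,4,7) assms(2) hd_in_set by fastforce
  moreover have "successively E p"
    using p(3) assms(3) by (rule successively_mono) auto
  ultimately show "u \<in> wreach E (Suc r) L v"
    unfolding wreach_def using p assms(1,4)
    by (intro CollectI exI[of _ "v # p"]) (auto simp: successively_Cons)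
qed

section \<open>The upper bound\<close>

text \<open>
  \<open>A u v\<close> reads: \<open>u\<close> is a neighbour of \<open>v\<close> that precedes it. Removing the vertices from the
  largest one downwards is then a perfect elimination.
\<close>

locale elimination_order =
  fixes k :: nat and A :: "nat \<Rightarrow> nat \<Rightarrow> bool"
  assumes less: "A u v \<Longrightarrow> u < v"
    and clique: "A u w \<Longrightarrow> A v w \<Longrightarrow> u < v \<Longrightarrow> A u v"
    and card_le: "card {u. A u v} \<le> k"
begin

lemma finite_back: "finite {u. A u v}"
  by (rule finite_subset[of _ "{..<v}"]) (auto dest: less)

end

text \<open>The last vertex of a descending walk is automatically its minimum, so the recursion
  follows smaller neighbours alone.\<close>

primrec desc_reach :: "(nat \<Rightarrow> nat \<Rightarrow> bool) \<Rightarrow> nat \<Rightarrow> nat \<Rightarrow> nat set" where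
  "desc_reach A 0 v = {v}"
| "desc_reach A (Suc r) v = insert v (\<Union>u\<in>{u. A u v}. desc_reach A r u)"

lemma desc_reach_self [simp]: "v \<in> desc_reach A r v"
  by (cases r) auto

lemma desc_reach_Suc_subset: "desc_reach A r v \<subseteq> desc_reach A (Suc r) v"
  by (induction r arbitrary: v) (simp, fastforce)

lemma desc_reach_mono: "r \<le> s \<Longrightarrow> desc_reach A r v \<subseteq> desc_reach A s v"
  by (rule lift_Suc_mono_le[of "\<lambda>r. desc_reach A r v"]) (rule desc_reach_Suc_subset)

context elimination_order
begin

lemma finite_desc_reach: "finite (desc_reach A r v)"
  by (induction r arbitrary: v) (auto simp: finite_back)

text \<open>Let \<open>x\<close> be the second vertex of the walk from \<open>w\<close>. Both
  \<open>x\<close> and \<open>v\<close> are smaller neighbours of \<open>w\<close>, hence equal or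
  adjacent. If \<open>x\<close> is below \<open>v\<close>, then \<open>v\<close> can step to
  \<open>x\<close> itself; if \<open>x\<close> is above \<open>v\<close>, induction applies to the
  rest of the walk.\<close>

lemma desc_reach_back:
  assumes "A v w" "u \<in> desc_reach A s w" "u \<le> v"
  shows "u \<in> desc_reach A s v"
  using assms
proof (induction s arbitrary: w)
  case 0
  then show ?case using less by fastforce
next
  case (Suc s)
  from Suc.prems less have "u \<noteq> w" by fastforce
  with Suc.prems obtain x where x: "A x w" "u \<in> desc_reach A s x" by auto
  consider "x = v" | "x < v" | "v < x" by linarith
  then show ?case
  proof cases
    case 1
    then show ?thesis using x desc_reach_Suc_subset by blast
  next
    case 2
    with clique[OF x(1) Suc.prems(1)] x(2) show ?thesis by auto
  next
    case 3
    with clique[OF Suc.prems(1) x(1)] have "A v x" by simp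
    then show ?thesis using Suc.IH x Suc.prems(3) desc_reach_Suc_subset by blast
  qed
qed

text \<open>A walk to its minimum can be shortcut at every internal local maximum until it descends.\<close>

lemma walk_to_min_in_desc_reach:
  assumes "p \<noteq> []" "successively (symclp A) p" "\<forall>w\<in>set p. last p \<le> w"
  shows "last p \<in> desc_reach A (length p - 1) (hd p)"
  using assms
proof (induction p)
  case Nil
  then show ?case by simp
next
  case (Cons v q)
  show ?case
  proof (cases "q = []")
    case True
    then show ?thesis by simp
  next
    case False
    let ?w = "hd q"
    have IH: "last q \<in> desc_reach A (length q - 1) ?w"
      using Cons False by (auto simp: successively_Cons)
    have len: "length q = Suc (length q - 1)" using False by (cases q) auto
    from Cons.prems False have "A v ?w \<or> A ?w v"
      by (auto simp: successively_Cons symclp_def)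
    then show ?thesis
    proof
      assume "A ?w v"
      with IH have "last q \<in> desc_reach A (Suc (length q - 1)) v" by auto
      with len False show ?thesis by simp
    next
      assume "A v ?w"
      with IH Cons.prems(3) False have "last q \<in> desc_reach A (length q - 1) v"
        by (auto intro: desc_reach_back)
      moreover have "desc_reach A (length q - 1) v \<subseteq> desc_reach A (length q) v"
        by (rule desc_reach_mono) simp
      ultimately show ?thesis using False by auto
    qed
  qed
qed

lemma wreach_id_subset_desc_reach: "wreach (symclp A) r id v \<subseteq> desc_reach A r v"
proof
  fix u assume "u \<in> wreach (symclp A) r id v"
  then obtain p where p: "p \<noteq> []" "successively (symclp A) p" "hd p = v" "last p = u"
    "length p \<le> Suc r" "\<forall>w\<in>set p. u \<le> w"
    unfolding wreach_def by auto
  then have "u \<in> desc_reach A (length p - 1) v"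
    using walk_to_min_in_desc_reach[of p] by auto
  moreover have "length p - 1 \<le> r" using p(5) by simp
  ultimately show "u \<in> desc_reach A r v" using desc_reach_mono by blast
qed

text \<open>The walk either stays above \<open>x\<close>, among neighbours of \<open>x\<close>, or
  enters \<open>{..x}\<close> at some point. The vertex of entry is \<open>x\<close> or a smaller
  neighbour of \<open>x\<close>, so the walk can begin at \<open>x\<close> instead without using
  more steps.\<close>

lemma desc_reach_split:
  assumes "A x w"
  shows "desc_reach A s w \<subseteq>
    desc_reach (\<lambda>u w. A u w \<and> x < u \<and> A x w) s w \<union> desc_reach A s x"
  using assms
proof (induction s arbitrary: w)
  case 0
  then show ?case by simp
next
  case (Suc s)
  let ?A = "\<lambda>u w. A u w \<and> x < u \<and> A x w"
  have "desc_reach A s y \<subseteq> desc_reach ?A (Suc s) w \<union> desc_reach A (Suc s) x" if "A y w" for y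
  proof -
    consider "y = x" | "y < x" | "x < y" by linarith
    then show ?thesis
    proof cases
      case 1
      then show ?thesis using desc_reach_Suc_subset by blast
    next
      case 2
      with clique[OF that Suc.prems] have "A y x" by simp
      then show ?thesis by auto
    next
      case 3
      with clique[OF Suc.prems that] have "A x y" by simp
      from Suc.IH[OF this] desc_reach_Suc_subset[of A s x] 3 that Suc.prems
      show ?thesis by auto
    qed
  qed
  then show ?case by auto
qed

end

lemma card_desc_reach_le:
  assumes "elimination_order k A"
  shows "card (desc_reach A r v) \<le> (r + k) choose k"
  using assms
proof (induction k arbitrary: A r v)
  case 0
  then interpret elimination_order 0 A .
  have "{u. A u v} = {}" using card_le finite_back by fastforce
  then have "desc_reach A r v = {v}" by (cases r) simp_all
  then show ?case by simp
next
  case (Suc k A r v)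
  interpret elimination_order "Suc k" A by fact
  note outer_IH = Suc.IH
  show ?case
  proof (induction r arbitrary: v)
    case 0
    then show ?case by simp
  next
    case (Suc r v)
    show ?case
    proof (cases "{u. A u v} = {}")
      case True
      then have "desc_reach A (Suc r) v = {v}" by simp
      then have "card (desc_reach A (Suc r) v) = 1" by (simp del: desc_reach.simps)
      also have "1 \<le> (Suc r + Suc k choose Suc k)"
        by (intro zero_less_binomial[THEN Suc_leI, folded One_nat_def]) simp
      finally show ?thesis .
    next
      case False
      \<comment> \<open>By minimality of \<open>x\<close>, the clique condition makes
        \<open>x\<close> a smaller neighbour of every other smaller neighbour of
        \<open>v\<close>.\<close>
      define x where "x = Min {u. A u v}"
      let ?A = "\<lambda>u w. A u w \<and> x < u \<and> A x w"
      have xv: "A x v"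
        using Min_in[OF finite_back False] unfolding x_def by simp
      have x_le: "x \<le> u" if "A u v" for u
        unfolding x_def using Min_le[OF finite_back] that by simp
      \<comment> \<open>A vertex with smaller neighbours under \<open>?A\<close> has
        \<open>x\<close> among those under \<open>A\<close>, and \<open>?A\<close> discards
        \<open>x\<close>; hence \<open>k\<close> in place of \<open>Suc k\<close>.\<close>
      have eo: "elimination_order k ?A"
      proof
        fix v
        show "card {u. A u v \<and> x < u \<and> A x v} \<le> k"
        proof (cases "A x v")
          case True
          have "{u. A u v \<and> x < u \<and> A x v} \<subseteq> {u. A u v} - {x}" by auto
          then have "card {u. A u v \<and> x < u \<and> A x v} \<le> card ({u. A u v} - {x})"
            using finite_back by (intro card_mono) auto
          also have "\<dots> \<le> k" using card_le[of v] True finite_back by simp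
          finally show ?thesis .
        next
          case False
          then show ?thesis by simp
        qed
      qed (auto dest: less clique)
      \<comment> \<open>The step from \<open>v\<close> to \<open>y\<close> has been spent, so a walk
        rerouted through \<open>x\<close> has only radius \<open>r\<close> left.\<close>
      have "desc_reach A r y \<subseteq> desc_reach ?A (Suc r) v \<union> desc_reach A r x" if "A y v" for y
      proof (cases "y = x")
        case False
        with x_le that have "x < y" by fastforce
        with clique[OF xv that] have "A x y" by simp
        from desc_reach_split[OF this] \<open>x < y\<close> that xv show ?thesis by auto
      qed auto
      then have "desc_reach A (Suc r) v \<subseteq> desc_reach ?A (Suc r) v \<union> desc_reach A r x"
        by auto
      then have "card (desc_reach A (Suc r) v) \<le> card (desc_reach ?A (Suc r) v \<union> desc_reach A r x)"
        by (intro card_mono finite_UnI finite_desc_reach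
            elimination_order.finite_desc_reach[OF eo])
      also have "\<dots> \<le> card (desc_reach ?A (Suc r) v) + card (desc_reach A r x)"
        by (rule card_Un_le)
      also have "\<dots> \<le> (Suc r + k choose k) + (r + Suc k choose Suc k)"
        by (intro add_mono Suc.IH outer_IH eo)
      finally show ?thesis by simp
    qed
  qed
qed

section \<open>The lower bound\<close>

text \<open>With \<open>back_exists\<close>, each vertex except \<open>0\<close> can be given a
  parent, which later makes the decomposition tree connected.\<close>

locale elimination_graph = elimination_order k A for k A +
  fixes n :: nat
  assumes pos: "0 < n"
    and bounded: "A u v \<Longrightarrow> v < n"
    and back_exists: "0 < v \<Longrightarrow> v < n \<Longrightarrow> \<exists>u. A u v"
begin

lemma bounded_fst: "A u v \<Longrightarrow> u < n"
  using less bounded less_trans by blast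

lemma symclp_bounded: "symclp A u v \<Longrightarrow> v < n"
  by (auto simp: symclp_def bounded bounded_fst)

lemma wreach_bounded: "v < n \<Longrightarrow> wreach (symclp A) r L v \<subseteq> {..<n}"
  by (rule wreach_subset) (auto dest: symclp_bounded)

lemma finite_wreach: "v < n \<Longrightarrow> finite (wreach (symclp A) r L v)"
  by (rule finite_subset[OF wreach_bounded]) auto

end

definition wcol_lower :: "nat \<Rightarrow> nat \<Rightarrow> nat \<Rightarrow> (nat \<Rightarrow> nat \<Rightarrow> bool) \<Rightarrow> bool" where
  "wcol_lower c r n A \<longleftrightarrow>
     (\<forall>L. inj_on L {..<n} \<longrightarrow> (\<exists>v<n. c \<le> card (wreach (symclp A) r L v)))"

text \<open>An order of the large graph restricts to the small one, and additional edges only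
  enlarge the reachable sets, which stay finite.\<close>

lemma wcol_lower_mono:
  assumes "wcol_lower c r n A" "n \<le> n'" "\<And>u v. A u v \<Longrightarrow> A' u v" "elimination_graph k A' n'"
  shows "wcol_lower c r n' A'"
  unfolding wcol_lower_def
proof (intro allI impI)
  fix L :: "nat \<Rightarrow> nat" assume "inj_on L {..<n'}"
  then have "inj_on L {..<n}" using assms(2) by (auto intro: inj_on_subset)
  then obtain v where v: "v < n" "c \<le> card (wreach (symclp A) r L v)"
    using assms(1) unfolding wcol_lower_def by blast
  have "wreach (symclp A) r L v \<subseteq> wreach (symclp A') r L v"
    by (rule wreach_mono) (use assms(3) in \<open>auto simp: symclp_def\<close>)
  then have "card (wreach (symclp A) r L v) \<le> card (wreach (symclp A') r L v)"
    using v(1) assms(2) elimination_graph.finite_wreach[OF assms(4)] by (intro card_mono) auto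
  with v assms(2) show "\<exists>v<n'. c \<le> card (wreach (symclp A') r L v)"
    by (intro exI[of _ v]) auto
qed

lemma wreach_edge:
  assumes "E v u" "u \<noteq> v" "L u \<le> L v"
  shows "u \<in> wreach E (Suc r) L v"
  unfolding wreach_def using assms by (intro CollectI exI[of _ "[v, u]"]) auto

text \<open>
  To every vertex \<open>x < n\<close> of the graph \<open>A\<close> we attach \<open>M\<close> copies of the graph \<open>B\<close>, and join
  \<open>x\<close> to all of their vertices. The vertex \<open>j < m\<close> of the copy with number \<open>t < M\<close> is
  \<open>copy x t j\<close>.
\<close>

locale copies =
  G: elimination_graph "Suc k" A n + H: elimination_graph k B m for k A n B m +
  fixes M :: nat
begin

text \<open>Mixed-radix numbering with digits \<open>x\<close>, \<open>t\<close> and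
  \<open>j\<close>: the copies occupy consecutive blocks of length \<open>m\<close> from
  \<open>n\<close> on. A copy thus lies above the vertex \<open>x < n\<close> it is attached to, and
  the order within a block is that of \<open>B\<close>.\<close>

definition copy :: "nat \<Rightarrow> nat \<Rightarrow> nat \<Rightarrow> nat" where
  "copy x t j = n + (x * M + t) * m + j"

lemma copy_ge: "n \<le> copy x t j" and not_copy_less: "\<not> copy x t j < n"
  by (auto simp: copy_def)

lemma copy_eq_iff:
  assumes "t < M" "t' < M" "j < m" "j' < m"
  shows "copy x t j = copy x' t' j' \<longleftrightarrow> x = x' \<and> t = t' \<and> j = j'"
proof
  assume "copy x t j = copy x' t' j'"
  then have eq: "(x * M + t) * m + j = (x' * M + t') * m + j'" by (simp add: copy_def)
  from arg_cong[OF this, of "\<lambda>a. a mod m"] assms have "j = j'" by simp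
  moreover from arg_cong[OF eq, of "\<lambda>a. a div m"] assms have eq': "x * M + t = x' * M + t'"
    by simp
  moreover from arg_cong[OF eq', of "\<lambda>a. a mod M"] assms have "t = t'" by simp
  moreover from arg_cong[OF eq', of "\<lambda>a. a div M"] assms have "x = x'" by simp
  ultimately show "x = x' \<and> t = t' \<and> j = j'" by simp
qed simp

lemma copy_less_iff: "copy x t i < copy x t j \<longleftrightarrow> i < j"
  by (simp add: copy_def)

lemma inj_copy: "inj (copy x t)"
  by (auto simp: inj_def copy_def)

definition total :: nat where "total = n + n * M * m"

lemma n_le_total: "n \<le> total"
  by (simp add: total_def)

lemma copy_less_total:
  assumes "x < n" "t < M" "j < m"
  shows "copy x t j < total"
proof -
  have "Suc x * M \<le> n * M" using assms(1) by (intro mult_le_mono) auto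
  then have "Suc (x * M + t) \<le> n * M" using assms(2) by simp
  then have "Suc (x * M + t) * m \<le> n * M * m" by (rule mult_le_mono1)
  then show ?thesis using assms(3) by (simp add: copy_def total_def)
qed

lemma vertex_cases:
  assumes "v < total"
  obtains "v < n" | x t j where "x < n" "t < M" "j < m" "v = copy x t j"
proof (cases "v < n")
  case False
  let ?c = "(v - n) div m"
  have "v - n < n * M * m" using assms False unfolding total_def by linarith
  then have c: "?c < n * M" by (simp add: less_mult_imp_div_less)
  then have "0 < M" by (cases M) auto
  moreover have "?c div M < n" using c by (simp add: less_mult_imp_div_less)
  moreover have "v = copy (?c div M) (?c mod M) ((v - n) mod m)"
    using False by (simp add: copy_def)
  ultimately show ?thesis using that(2) H.pos by (meson mod_less_divisor)
qed (use that(1) in simp)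

definition adj :: "nat \<Rightarrow> nat \<Rightarrow> bool" where
  "adj u v \<longleftrightarrow> A u v \<or>
     (\<exists>x<n. \<exists>t<M. \<exists>j<m. v = copy x t j \<and> (u = x \<or> (\<exists>i. B i j \<and> u = copy x t i)))"

lemma adjI_left: "A u v \<Longrightarrow> adj u v"
  by (simp add: adj_def)

lemma adj_less_iff: "v < n \<Longrightarrow> adj u v \<longleftrightarrow> A u v"
  by (auto simp: adj_def not_copy_less)

lemma adj_copy_iff:
  assumes "x < n" "t < M" "j < m"
  shows "adj u (copy x t j) \<longleftrightarrow> u = x \<or> (\<exists>i. B i j \<and> u = copy x t i)"
proof -
  have "\<not> A u (copy x t j)" using G.bounded not_copy_less by blast
  then show ?thesis
    using assms unfolding adj_def by (auto simp: copy_eq_iff)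
qed

lemma adj_cases:
  assumes "adj u v"
  obtains "v < n" "A u v" | x t j where "x < n" "t < M" "j < m" "v = copy x t j"
  using assms G.bounded unfolding adj_def by blast

text \<open>A vertex of a copy gains just \<open>x\<close> as a smaller neighbour, and
  \<open>x\<close> is joined to the whole copy. Cliques therefore remain cliques, and the bound
  \<open>k\<close> grows by one.\<close>

lemma elimination_graph_adj: "elimination_graph (Suc k) adj total"
proof
  show "0 < total" using G.pos by (simp add: total_def)
next
  fix u v assume "adj u v"
  then show "v < total"
    by (cases rule: adj_cases) (auto simp: copy_less_total intro: less_le_trans[OF _ n_le_total])
next
  fix v assume "0 < v" "v < total"
  from \<open>v < total\<close> show "\<exists>u. adj u v"
    by (cases rule: vertex_cases)
      (use \<open>0 < v\<close> G.back_exists adjI_left adj_copy_iff in blast)+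
next
  fix u v assume "adj u v"
  then show "u < v"
  proof (cases rule: adj_cases)
    case (2 x t j)
    with \<open>adj u v\<close> have "u = x \<or> (\<exists>i. B i j \<and> u = copy x t i)" by (simp add: adj_copy_iff)
    then show ?thesis
      using 2(1,4) copy_ge[of x t j] by (auto simp: copy_less_iff dest: H.less)
  qed (rule G.less)
next
  fix u v w assume "adj u w" "adj v w" "u < v"
  from \<open>adj u w\<close> show "adj u v"
  proof (cases rule: adj_cases)
    case 1
    then have "A v w" using \<open>adj v w\<close> by (simp add: adj_less_iff)
    from G.clique[OF 1(2) this \<open>u < v\<close>] show ?thesis by (rule adjI_left)
  next
    case (2 x t j)
    with \<open>adj u w\<close> \<open>adj v w\<close>
    have u: "u = x \<or> (\<exists>i. B i j \<and> u = copy x t i)"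
      and v: "v = x \<or> (\<exists>i. B i j \<and> v = copy x t i)" by (simp_all add: adj_copy_iff)
    \<comment> \<open>As \<open>x\<close> is the least smaller neighbour of \<open>w\<close>, the
      larger vertex \<open>v\<close> must lie in the copy.\<close>
    have "x \<le> u" using u 2(1) copy_ge[of x t] by (auto intro: less_imp_le less_le_trans)
    then have "v \<noteq> x" using \<open>u < v\<close> by simp
    then obtain i where i: "B i j" "v = copy x t i" using v by auto
    with 2 have "i < m" using H.bounded_fst by blast
    from u show ?thesis
    proof
      assume "u = x"
      then show ?thesis using i 2 \<open>i < m\<close> by (simp add: adj_copy_iff)
    next
      assume "\<exists>i. B i j \<and> u = copy x t i"
      then obtain i' where i': "B i' j" "u = copy x t i'" by auto
      with i \<open>u < v\<close> have "i' < i" by (simp add: copy_less_iff)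
      with H.clique[OF i'(1) i(1)] have "B i' i" .
      then show ?thesis using i i' 2 \<open>i < m\<close> by (auto simp: adj_copy_iff)
    qed
  qed
next
  fix v
  show "card {u. adj u v} \<le> Suc k"
  proof (cases "\<exists>u. adj u v")
    case True
    then obtain u where "adj u v" by blast
    then show ?thesis
    proof (cases rule: adj_cases)
      case 1
      then show ?thesis using G.card_le[of v] by (simp add: adj_less_iff)
    next
      case (2 x t j)
      then have "{u. adj u v} = insert x (copy x t ` {i. B i j})"
        by (auto simp: adj_copy_iff)
      also have "card \<dots> \<le> Suc (card (copy x t ` {i. B i j}))"
        by (simp add: card_insert_le_m1 card_insert_if H.finite_back)
      also have "\<dots> \<le> Suc (card {i. B i j})"
        by (simp add: card_image_le H.finite_back)
      also have "\<dots> \<le> Suc k" using H.card_le by simp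
      finally show ?thesis .
    qed
  qed simp
qed

text \<open>
  Let \<open>x\<close> be good for \<open>A\<close> and radius \<open>r\<close>. If each copy at \<open>x\<close> contains a vertex below \<open>x\<close>, these
  \<open>M\<close> vertices are weakly reachable from \<open>x\<close>. Otherwise some copy lies above \<open>x\<close> entirely, and
  its best vertex reaches, besides what it reaches in the copy, all that \<open>x\<close> reaches with one
  step less. This is Pascal's recurrence.
\<close>

lemma wcol_lower_adj:
  assumes A: "wcol_lower a r n A" and B: "wcol_lower b (Suc r) m B" and M: "a + b \<le> M"
  shows "wcol_lower (a + b) (Suc r) total adj"
  unfolding wcol_lower_def
proof (intro allI impI)
  fix L :: "nat \<Rightarrow> nat" assume L: "inj_on L {..<total}"
  interpret adj: elimination_graph "Suc k" adj total by (rule elimination_graph_adj)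
  have "inj_on L {..<n}" using L n_le_total by (auto intro: inj_on_subset)
  then obtain x where x: "x < n" "a \<le> card (wreach (symclp A) r L x)"
    using A unfolding wcol_lower_def by blast
  show "\<exists>v<total. a + b \<le> card (wreach (symclp adj) (Suc r) L v)"
  proof (cases "\<exists>t<M. \<forall>j<m. L x < L (copy x t j)")
    case True
    then obtain t where t: "t < M" "\<forall>j<m. L x < L (copy x t j)" by blast
    have "inj_on (L \<circ> copy x t) {..<m}"
      using x t copy_less_total
      by (intro comp_inj_on inj_on_subset[OF inj_copy] inj_on_subset[OF L]) auto
    then obtain j where j: "j < m" "b \<le> card (wreach (symclp B) (Suc r) (L \<circ> copy x t) j)"
      using B unfolding wcol_lower_def by blast
    let ?v = "copy x t j"
    let ?W = "wreach (symclp adj) (Suc r) L ?v"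
    let ?S = "copy x t ` wreach (symclp B) (Suc r) (L \<circ> copy x t) j"
    let ?T = "wreach (symclp A) r L x"
    have adjB: "symclp adj (copy x t i) (copy x t i')" if "symclp B i i'" for i i'
      using that x(1) t(1) H.bounded by (auto simp: symclp_def adj_copy_iff)
    have "?S \<subseteq> ?W" by (intro wreach_image inj_copy adjB)
    \<comment> \<open>Paths from \<open>x\<close> in the graph \<open>A\<close> avoid all copies;
      prepending the edge from \<open>?v\<close> to \<open>x\<close> turns radius \<open>r\<close>
      into \<open>Suc r\<close>.\<close>
    moreover have "?T \<subseteq> ?W"
    proof (rule wreach_step[where S = "{..<n}"])
      show "symclp adj ?v x" using x(1) t(1) j(1) by (simp add: symclp_def adj_copy_iff)
    qed (use x t j G.symclp_bounded in \<open>auto simp: symclp_def adjI_left not_copy_less\<close>)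
    ultimately have "card (?T \<union> ?S) \<le> card ?W"
      using x t j copy_less_total by (intro card_mono adj.finite_wreach) auto
    moreover have "card (?T \<union> ?S) = card ?T + card ?S"
    proof (rule card_Un_disjoint)
      show "?T \<inter> ?S = {}"
        using G.wreach_bounded[OF x(1), of r L] not_copy_less by blast
    qed (use x(1) j(1) G.finite_wreach H.finite_wreach in auto)
    moreover have "card ?S = card (wreach (symclp B) (Suc r) (L \<circ> copy x t) j)"
      using inj_copy by (intro card_image) (auto intro: inj_on_subset)
    ultimately have "a + b \<le> card ?W" using x(2) j(2) by linarith
    then show ?thesis using copy_less_total x(1) t(1) j(1) by blast
  next
    case False
    then have "\<forall>t. \<exists>j. t < M \<longrightarrow> j < m \<and> L (copy x t j) \<le> L x" by (meson not_less)
    then obtain g where g: "\<And>t. t < M \<Longrightarrow> g t < m \<and> L (copy x t (g t)) \<le> L x" by metis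
    let ?W = "wreach (symclp adj) (Suc r) L x"
    let ?S = "(\<lambda>t. copy x t (g t)) ` {..<M}"
    have "x < total" using x(1) n_le_total by simp
    have "?S \<subseteq> ?W"
    proof clarify
      fix t assume "t < M"
      from g[OF this] show "copy x t (g t) \<in> ?W"
        using \<open>t < M\<close> x(1) copy_ge[of x t "g t"]
        by (intro wreach_edge) (simp_all add: symclp_def adj_copy_iff)
    qed
    then have "card ?S \<le> card ?W"
      using \<open>x < total\<close> by (intro card_mono adj.finite_wreach)
    moreover have "card ?S = M"
      using g by (subst card_image) (auto simp: inj_on_def copy_eq_iff)
    ultimately show ?thesis using M \<open>x < total\<close> by (intro exI[of _ x]) auto
  qed
qed

text \<open>The vertex \<open>0\<close> is joined to all of its first copy of \<open>B\<close>, so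
  it extends the clique found there.\<close>

lemma clique_adj:
  assumes "C \<subseteq> {..<m}" "\<And>u v. u \<in> C \<Longrightarrow> v \<in> C \<Longrightarrow> u < v \<Longrightarrow> B u v" "0 < M"
  shows "\<exists>C'\<subseteq>{..<total}. card C' = Suc (card C) \<and> (\<forall>u\<in>C'. \<forall>v\<in>C'. u < v \<longrightarrow> adj u v)"
proof (intro exI conjI)
  let ?C = "insert 0 (copy 0 0 ` C)"
  have fin: "finite C" using assms(1) finite_subset by blast
  show "?C \<subseteq> {..<total}"
    using assms(1,3) G.pos copy_less_total by (auto simp: total_def)
  have "0 \<notin> copy 0 0 ` C" using G.pos not_copy_less[of 0 0] by (metis imageE)
  then show "card ?C = Suc (card C)"
    using fin by (simp add: card_image inj_on_subset[OF inj_copy])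
  show "\<forall>u\<in>?C. \<forall>v\<in>?C. u < v \<longrightarrow> adj u v"
  proof (intro ballI impI)
    fix u v assume u: "u \<in> ?C" and v: "v \<in> ?C" and "u < v"
    from v \<open>u < v\<close> obtain j where j: "j \<in> C" "v = copy 0 0 j" by auto
    then have "j < m" using assms(1) by auto
    from u show "adj u v"
    proof
      assume "u \<in> copy 0 0 ` C"
      then obtain i where i: "i \<in> C" "u = copy 0 0 i" by blast
      then have "i < j" using j(2) \<open>u < v\<close> by (simp add: copy_less_iff)
      with assms(2) i(1) j(1) have "B i j" by blast
      then show ?thesis using i(2) j(2) \<open>j < m\<close> assms(3) G.pos by (auto simp: adj_copy_iff)
    qed (use j(2) \<open>j < m\<close> assms(3) G.pos in \<open>simp add: adj_copy_iff\<close>)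
  qed
qed

end

section \<open>Iterating the construction from a single vertex\<close>

lemma elimination_graph_single: "elimination_graph k (\<lambda>u v. False) 1"
  by unfold_locales auto

lemma wcol_lower_single: "wcol_lower 1 r 1 (\<lambda>u v. False)"
proof -
  interpret elimination_graph 0 "\<lambda>u v. False" 1 by (rule elimination_graph_single)
  have "wreach (symclp (\<lambda>u v. False)) r L 0 \<noteq> {}" for L :: "nat \<Rightarrow> nat"
    by (metis empty_iff wreach_self)
  then show ?thesis
    unfolding wcol_lower_def by (auto simp: Suc_le_eq card_gt_0_iff finite_wreach)
qed

text \<open>Outer induction on \<open>k\<close>, inner induction on \<open>r\<close>. The base cases
  are single vertices; for \<open>r = 0\<close> this contains no clique on \<open>Suc k\<close>
  vertices unless \<open>k = 0\<close>, whence the guard \<open>0 < r\<close>.\<close>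

lemma extremal_graph_exists:
  "\<exists>n A. elimination_graph k A n \<and> (\<forall>r'\<le>r. wcol_lower ((r' + k) choose k) r' n A) \<and>
     (0 < r \<longrightarrow> (\<exists>C\<subseteq>{..<n}. card C = Suc k \<and> (\<forall>u\<in>C. \<forall>v\<in>C. u < v \<longrightarrow> A u v)))"
proof (induction k arbitrary: r)
  case 0
  show ?case
  proof (intro exI[of _ 1] exI[of _ "\<lambda>u v. False"] conjI elimination_graph_single impI)
    show "\<exists>C\<subseteq>{..<1::nat}. card C = Suc 0 \<and> (\<forall>u\<in>C. \<forall>v\<in>C. u < v \<longrightarrow> False)"
      by (intro exI[of _ "{0}"]) auto
  qed (simp add: wcol_lower_single[unfolded One_nat_def])
next
  case (Suc k r)
  note outer_IH = Suc.IH
  show ?case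
  proof (induction r)
    case 0
    show ?case
      by (intro exI[of _ 1] exI[of _ "\<lambda>u v. False"] conjI elimination_graph_single)
        (simp_all add: wcol_lower_single[unfolded One_nat_def])
  next
    case (Suc r)
    obtain n A where A: "elimination_graph (Suc k) A n"
      "\<And>r'. r' \<le> r \<Longrightarrow> wcol_lower ((r' + Suc k) choose Suc k) r' n A"
      using Suc.IH by blast
    \<comment> \<open>The radius \<open>Suc r\<close> is positive, so the hypothesis for
      \<open>k\<close> also provides a clique.\<close>
    obtain m B C where B: "elimination_graph k B m"
      "wcol_lower ((Suc r + k) choose k) (Suc r) m B"
      and C: "C \<subseteq> {..<m}" "card C = Suc k" "\<And>u v. u \<in> C \<Longrightarrow> v \<in> C \<Longrightarrow> u < v \<Longrightarrow> B u v"
      using outer_IH[of "Suc r"] by blast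
    define M where "M = (r + Suc k choose Suc k) + (Suc r + k choose k)"
    have "0 < M" by (simp add: M_def)
    interpret copies k A n B m M
      by (intro copies.intro A(1) B(1))
    have "wcol_lower (r' + Suc k choose Suc k) r' total adj" if "r' \<le> Suc r" for r'
    proof (cases "r' = Suc r")
      case True
      have "(Suc r + Suc k) choose Suc k = (r + Suc k choose Suc k) + (Suc r + k choose k)"
        by simp
      then show ?thesis
        unfolding True using wcol_lower_adj[OF A(2) B(2)] by (simp only: M_def)
    next
      case False
      \<comment> \<open>Smaller radii are inherited from the subgraph \<open>A\<close>.\<close>
      then show ?thesis
        using that by (intro wcol_lower_mono[OF A(2) _ adjI_left elimination_graph_adj])
          (auto simp: total_def)
    qed
    moreover have "\<exists>C\<subseteq>{..<total}. card C = Suc (Suc k) \<and> (\<forall>u\<in>C. \<forall>v\<in>C. u < v \<longrightarrow> adj u v)"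
      using clique_adj[OF C(1,3) \<open>0 < M\<close>] unfolding C(2) .
    ultimately show ?case
      using elimination_graph_adj by blast
  qed
qed

section \<open>Cliques and tree decompositions\<close>

text \<open>For symmetric arcs the symmetric closure in the notion of connectedness changes nothing,
  which leaves reachability within \<open>S\<close>.\<close>

lemma connected_iff_rtrancl:
  assumes "sym (parcs T)" "S \<subseteq> pverts T"
  shows "Digraph_Component.connected (with_proj T \<restriction> S) \<longleftrightarrow>
    S \<noteq> {} \<and> (\<forall>u\<in>S. \<forall>v\<in>S. (u, v) \<in> (Restr (parcs T) S)\<^sup>*)"
proof -
  let ?Q = "Restr (parcs T) S"
  have Q: "arcs_ends (with_proj (mk_symmetric (with_proj T \<restriction> S))) = ?Q"
    using assms(1) by (auto simp: parcs_mk_symmetric sym_def)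
  have "(u, v) \<in> rtrancl_on S ?Q \<longleftrightarrow> (u, v) \<in> ?Q\<^sup>*" if "u \<in> S" for u v
  proof
    assume "(u, v) \<in> ?Q\<^sup>*"
    then show "(u, v) \<in> rtrancl_on S ?Q"
      by (induction rule: rtrancl_induct) (auto intro: rtrancl_on_into_rtrancl_on that)
  qed (rule rtrancl_on_rtranclI)
  then show ?thesis
    unfolding Digraph_Component.connected_def strongly_connected_def reachable_def Q
    by auto
qed

lemma connected_restrict_pverts:
  assumes "pair_wf_digraph T"
  shows "with_proj T \<restriction> pverts T = with_proj T"
  using assms by (auto simp: induce_subgraph_def with_proj_def pair_wf_digraph_def)

lemma (in pair_graph) sym_parcs: "sym (parcs G)"
  using pair_sym_arcs by (simp add: symmetric_def)

section \<open>Leaves of forests and the Helly property\<close>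

lemma forest_leaf:
  assumes "finite V" "V \<noteq> {}" "R \<subseteq> V \<times> V" "sym R" "irrefl R"
    and acyclic: "\<And>c. distinct c \<Longrightarrow> successively (\<lambda>a b. (a, b) \<in> R) c \<Longrightarrow> 3 \<le> length c \<Longrightarrow>
      (last c, hd c) \<notin> R"
  obtains t s where "t \<in> V" "\<And>u. (t, u) \<in> R \<Longrightarrow> u = s"
proof -
  let ?P = "\<lambda>p. p \<noteq> [] \<and> distinct p \<and> set p \<subseteq> V \<and> successively (\<lambda>a b. (a, b) \<in> R) p"
  obtain v where "v \<in> V" using assms(2) by blast
  have "length p < Suc (card V)" if "?P p" for p
    using that card_mono[OF assms(1), of "set p"] by (simp add: distinct_card)
  moreover have "?P [v]" using \<open>v \<in> V\<close> by simp
  \<comment> \<open>On a longest path, a neighbour of the first vertex other than the second would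
    extend the path or close a cycle.\<close>
  ultimately obtain p where p: "?P p" "\<And>q. ?P q \<Longrightarrow> length q \<le> length p"
    using ex_has_greatest_nat[of ?P "[v]" length "Suc (card V)"] by blast
  obtain t q where tq: "p = t # q" using p(1) by (cases p) auto
  have "u = hd q" if u: "(t, u) \<in> R" for u
  proof (rule ccontr)
    assume "u \<noteq> hd q"
    have "u \<noteq> t" using u assms(5) by (auto simp: irrefl_def)
    have ut: "(u, t) \<in> R" using u assms(4) by (simp add: sym_def)
    have "u \<in> set p"
    proof (rule ccontr)
      assume "u \<notin> set p"
      then have "?P (u # p)" using p(1) tq ut u assms(3) by (auto simp: successively_Cons)
      then show False using p(2)[of "u # p"] by simp
    qed
    then obtain q1 q2 where q: "q = q1 @ u # q2"
      using tq \<open>u \<noteq> t\<close> by (auto dest: split_list)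
    with \<open>u \<noteq> hd q\<close> have "q1 \<noteq> []" by auto
    have "successively (\<lambda>a b. (a, b) \<in> R) ((t # q1 @ [u]) @ q2)" "distinct ((t # q1 @ [u]) @ q2)"
      using p(1) tq q by simp_all
    then have "successively (\<lambda>a b. (a, b) \<in> R) (t # q1 @ [u])" "distinct (t # q1 @ [u])"
      unfolding successively_append_iff distinct_append by blast+
    moreover have "3 \<le> length (t # q1 @ [u])" using \<open>q1 \<noteq> []\<close> by (cases q1) auto
    ultimately show False using acyclic[of "t # q1 @ [u]"] ut by simp
  qed
  then show ?thesis using that[of t "hd q"] p(1) tq by auto
qed

lemma rtrancl_avoid_leaf:
  assumes "sym Q" "irrefl Q" "\<And>u. (t, u) \<in> Q \<Longrightarrow> u = s"
    and "(a, b) \<in> Q\<^sup>*" "a \<noteq> t" "b \<noteq> t"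
  shows "(a, b) \<in> (Restr Q (- {t}))\<^sup>*"
proof -
  let ?Q = "Restr Q (- {t})"
  \<comment> \<open>The invariant replaces the endpoint \<open>t\<close> by \<open>s\<close>: a
    visit to the leaf comes from \<open>s\<close> and returns to \<open>s\<close>, so it can be cut
    out.\<close>
  from \<open>(a, b) \<in> Q\<^sup>*\<close> have "(a, if b = t then s else b) \<in> ?Q\<^sup>*"
  proof (induction rule: rtrancl_induct)
    case base
    then show ?case using assms(5) by simp
  next
    case (step y z)
    consider "y = t" | "z = t" "y \<noteq> t" | "y \<noteq> t" "z \<noteq> t" by blast
    then show ?case
    proof cases
      case 1
      then have "z = s" "z \<noteq> t" using step(2) assms(2,3) by (auto simp: irrefl_def)
      then show ?thesis using step(3) 1 by simp
    next
      case 2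
      then have "y = s" using step(2) assms(1,3) by (auto simp: sym_def)
      then show ?thesis using step(3) 2 by simp
    next
      case 3
      then have "(y, z) \<in> ?Q" using step(2) by simp
      then show ?thesis using step(3) 3 by (simp add: rtrancl_into_rtrancl)
    qed
  qed
  then show ?thesis using assms(6) by simp
qed

text \<open>
  The Helly property of subtrees, by removing leaves: either some member of \<open>C\<close> lies in the
  bag of the leaf \<open>t\<close> only, and then \<open>t\<close> is the node sought, or the bag of \<open>t\<close> is contained,
  as far as \<open>C\<close> is concerned, in that of the neighbour of \<open>t\<close>.
\<close>

lemma pairwise_bag_imp_common_bag:
  assumes "finite V" "R \<subseteq> V \<times> V" "sym R" "irrefl R"
    and "\<And>c. distinct c \<Longrightarrow> successively (\<lambda>a b. (a, b) \<in> R) c \<Longrightarrow> 3 \<le> length c \<Longrightarrow>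
      (last c, hd c) \<notin> R"
    and "C \<noteq> {}"
    and "\<And>u v. u \<in> C \<Longrightarrow> v \<in> C \<Longrightarrow> \<exists>t\<in>V. u \<in> B t \<and> v \<in> B t"
    and "\<And>v a b. v \<in> C \<Longrightarrow> a \<in> V \<Longrightarrow> b \<in> V \<Longrightarrow> v \<in> B a \<Longrightarrow> v \<in> B b \<Longrightarrow>
      (a, b) \<in> (Restr R {t \<in> V. v \<in> B t})\<^sup>*"
  shows "\<exists>t\<in>V. C \<subseteq> B t"
  using assms
proof (induction "card V" arbitrary: V R rule: less_induct)
  case less
  note prems = less.prems
  have "V \<noteq> {}" using prems(6,7) by blast
  from forest_leaf[OF prems(1) this prems(2-5)]
  obtain t s where t: "t \<in> V" "\<And>u. (t, u) \<in> R \<Longrightarrow> u = s" by blast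
  show ?case
  proof (cases "\<exists>v\<in>C. v \<in> B t \<and> (\<forall>u\<in>V. v \<in> B u \<longrightarrow> u = t)")
    case True
    then obtain v where v: "v \<in> C" "\<And>u. u \<in> V \<Longrightarrow> v \<in> B u \<Longrightarrow> u = t" by blast
    have "C \<subseteq> B t"
    proof
      fix u assume "u \<in> C"
      then show "u \<in> B t" using prems(7)[of u v] v by blast
    qed
    with t(1) show ?thesis by blast
  next
    case False
    \<comment> \<open>Some node other than \<open>t\<close> also holds \<open>v\<close>, and the
      first edge of a walk to it from \<open>t\<close> leads to \<open>s\<close>.\<close>
    have s: "s \<in> V \<and> s \<noteq> t \<and> v \<in> B s" if v: "v \<in> C" "v \<in> B t" for v
    proof -
      obtain b where b: "b \<in> V" "v \<in> B b" "b \<noteq> t" using False v by blast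
      obtain y where "(t, y) \<in> Restr R {t \<in> V. v \<in> B t}"
        using prems(8)[OF v(1) t(1) b(1) v(2) b(2)] b(3) by (auto elim: converse_rtranclE)
      then show ?thesis using t(2)[of y] prems(4) by (auto simp: irrefl_def)
    qed
    let ?V = "V - {t}"
    let ?R = "Restr R ?V"
    have "\<exists>t\<in>?V. C \<subseteq> B t"
    proof (rule less.hyps)
      show "card ?V < card V" using t(1) prems(1) by (intro psubset_card_mono) auto
      show "finite ?V" "?R \<subseteq> ?V \<times> ?V" "C \<noteq> {}" using prems by auto
      show "sym ?R" "irrefl ?R" using prems(3,4) by (auto simp: sym_def irrefl_def)
      show "(last c, hd c) \<notin> ?R"
        if "distinct c" "successively (\<lambda>a b. (a, b) \<in> ?R) c" "3 \<le> length c" for c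
      proof -
        have "successively (\<lambda>a b. (a, b) \<in> R) c"
          using that(2) by (rule successively_mono) auto
        then show ?thesis using prems(5)[OF that(1) _ that(3)] by blast
      qed
      show "\<exists>t\<in>?V. u \<in> B t \<and> v \<in> B t" if "u \<in> C" "v \<in> C" for u v
        using prems(7)[OF that] s that by blast
      fix v a b assume v: "v \<in> C" "a \<in> ?V" "b \<in> ?V" "v \<in> B a" "v \<in> B b"
      let ?Q = "Restr R {t \<in> V. v \<in> B t}"
      have "(a, b) \<in> (Restr ?Q (- {t}))\<^sup>*"
      proof (rule rtrancl_avoid_leaf)
        show "sym ?Q" "irrefl ?Q" using prems(3,4) by (auto simp: sym_def irrefl_def)
        show "(a, b) \<in> ?Q\<^sup>*" using prems(8) v by blast
      qed (use t(2) v in auto)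
      also have "Restr ?Q (- {t}) = Restr ?R {t \<in> ?V. v \<in> B t}" by auto
      finally show "(a, b) \<in> (Restr ?R {t \<in> ?V. v \<in> B t})\<^sup>*" .
    qed
    then show ?thesis by blast
  qed
qed

text \<open>Each edge lies in a bag, so the subtrees of the members of \<open>C\<close> meet
  pairwise, and the Helly property gives a common node.\<close>

lemma clique_in_bag:
  assumes "tree_decomposition G T B" "C \<noteq> {}" "C \<subseteq> pverts G"
    and "\<And>u v. u \<in> C \<Longrightarrow> v \<in> C \<Longrightarrow> u \<noteq> v \<Longrightarrow> (u, v) \<in> parcs G"
  shows "\<exists>t\<in>pverts T. C \<subseteq> B t"
proof (rule pairwise_bag_imp_common_bag[of _ "parcs T"])
  from assms(1) have T: "undirected_tree T" and V: "(\<Union>t\<in>pverts T. B t) = pverts G"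
    and E: "\<forall>(u, v)\<in>parcs G. \<exists>t\<in>pverts T. u \<in> B t \<and> v \<in> B t"
    and conn: "\<forall>v\<in>pverts G.
      Digraph_Component.connected (with_proj T \<restriction> {t \<in> pverts T. v \<in> B t})"
    unfolding tree_decomposition_def by blast+
  interpret T: pair_graph T using T by (simp add: undirected_tree_def)
  show "finite (pverts T)" by (rule T.pair_finite_verts)
  show sub: "parcs T \<subseteq> pverts T \<times> pverts T" using T.wellformed' by auto
  show sym: "sym (parcs T)" by (rule T.sym_parcs)
  show "irrefl (parcs T)" using T.pair_no_loops by (fastforce simp: irrefl_def)
  show "(last c, hd c) \<notin> parcs T"
    if "distinct c" "successively (\<lambda>a b. (a, b) \<in> parcs T) c" "3 \<le> length c" for c
  proof
    assume "(last c, hd c) \<in> parcs T"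
    moreover from this have "set c \<subseteq> pverts T"
      using successively_set_subset[OF that(2)] sub by blast
    moreover have "c \<noteq> []" using that(3) by auto
    ultimately show False
      using T that unfolding undirected_tree_def vpath_with_proj_iff by blast
  qed
  show "C \<noteq> {}" by fact
  show "\<exists>t\<in>pverts T. u \<in> B t \<and> v \<in> B t" if "u \<in> C" "v \<in> C" for u v
  proof (cases "u = v")
    case True
    then show ?thesis using V that assms(3) by blast
  next
    case False
    then show ?thesis using E assms(4)[OF that] by blast
  qed
  show "(a, b) \<in> (Restr (parcs T) {t \<in> pverts T. v \<in> B t})\<^sup>*"
    if "v \<in> C" "a \<in> pverts T" "b \<in> pverts T" "v \<in> B a" "v \<in> B b" for v a b
  proof -
    have "Digraph_Component.connected (with_proj T \<restriction> {t \<in> pverts T. v \<in> B t})"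
      using conn that(1) assms(3) by blast
    then show ?thesis
      using connected_iff_rtrancl[OF sym, of "{t \<in> pverts T. v \<in> B t}"] that by blast
  qed
qed

lemma decomposition_width_ge:
  assumes "tree_decomposition G T B" "finite (pverts G)" "C \<subseteq> pverts G" "card C = Suc k"
    and "\<And>u v. u \<in> C \<Longrightarrow> v \<in> C \<Longrightarrow> u \<noteq> v \<Longrightarrow> (u, v) \<in> parcs G"
  shows "k \<le> decomposition_width T B"
proof -
  have "finite (pverts T)"
    using assms(1)
    by (simp add: tree_decomposition_def undirected_tree_def pair_graph_def
        pair_digraph_def pair_fin_digraph.pair_finite_verts)
  have "C \<noteq> {}" using assms(4) by auto
  then obtain t where t: "t \<in> pverts T" "C \<subseteq> B t"
    using clique_in_bag assms(1,3,5) by metis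
  have "B t \<subseteq> pverts G" using assms(1) t(1) unfolding tree_decomposition_def by blast
  then have "finite (B t)" using assms(2) by (rule finite_subset)
  then have "Suc k \<le> card (B t)" using card_mono t(2) assms(4) by metis
  also have "\<dots> \<le> (MAX t\<in>pverts T. card (B t))"
    using \<open>finite (pverts T)\<close> t(1) by (intro Max_ge) auto
  finally show ?thesis by (simp add: decomposition_width_def)
qed

section \<open>The decomposition along an elimination order\<close>

definition graph_of :: "nat \<Rightarrow> (nat \<Rightarrow> nat \<Rightarrow> bool) \<Rightarrow> nat pair_pre_digraph" where
  "graph_of n A = \<lparr>pverts = {..<n}, parcs = {(u, v). symclp A u v}\<rparr>"

lemma graph_of_simps [simp]:
  "pverts (graph_of n A) = {..<n}" "(u, v) \<in> parcs (graph_of n A) \<longleftrightarrow> symclp A u v"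
  by (simp_all add: graph_of_def)

lemma sym_graph_of: "sym (parcs (graph_of n A))"
  by (auto simp: sym_def symclp_def)

context elimination_graph
begin

lemma pair_graph_graph_of: "pair_graph (graph_of n A)"
proof unfold_locales
  have sub: "parcs (graph_of n A) \<subseteq> {..<n} \<times> {..<n}"
    by (auto simp: symclp_def bounded bounded_fst)
  show "fst e \<in> pverts (graph_of n A)" "snd e \<in> pverts (graph_of n A)"
    if "e \<in> parcs (graph_of n A)" for e
    using sub that by auto
  show "finite (parcs (graph_of n A))" using sub by (rule finite_subset) simp
  show "fst e \<noteq> snd e" if "e \<in> parcs (graph_of n A)" for e
    using that less by (cases e) (auto simp: symclp_def)
  show "symmetric (with_proj (graph_of n A))"
    by (simp add: symmetric_def sym_graph_of)
qed simp

text \<open>With the largest choice, the clique condition makes all other smaller neighbours of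
  \<open>v\<close> smaller neighbours of its parent.\<close>

definition parent :: "nat \<Rightarrow> nat" where "parent v = Max {u. A u v}"

text \<open>The root \<open>0\<close> is excluded, since its parent would be the maximum of an empty
  set.\<close>

definition parent_rel :: "nat \<Rightarrow> nat \<Rightarrow> bool" where
  "parent_rel u v \<longleftrightarrow> 0 < v \<and> v < n \<and> u = parent v"

lemma adj_parent:
  assumes "0 < v" "v < n"
  shows "A (parent v) v"
proof -
  have "{u. A u v} \<noteq> {}" using back_exists[OF assms] by simp
  from Max_in[OF finite_back this] show ?thesis by (simp add: parent_def)
qed

lemma le_parent: "A u v \<Longrightarrow> u \<le> parent v"
  unfolding parent_def by (rule Max_ge[OF finite_back]) simp

lemma parent_rel_less: "parent_rel u v \<Longrightarrow> u < v"
  using adj_parent less by (auto simp: parent_rel_def)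

text \<open>Parents decrease, so climbing from any node of \<open>S\<close> stays in
  \<open>S\<close> and ends at \<open>s\<close>.\<close>

lemma connected_subtree:
  assumes "S \<subseteq> {..<n}" "s \<in> S" "\<And>t. t \<in> S \<Longrightarrow> t \<noteq> s \<Longrightarrow> 0 < t \<and> parent t \<in> S"
  shows "Digraph_Component.connected (with_proj (graph_of n parent_rel) \<restriction> S)"
proof -
  let ?Q = "Restr (parcs (graph_of n parent_rel)) S"
  have sym: "sym (?Q\<^sup>*)"
    by (rule sym_rtrancl) (auto simp: sym_def symclp_def)
  have root: "(t, s) \<in> ?Q\<^sup>*" if "t \<in> S" for t
    using that
  proof (induction t rule: less_induct)
    case (less t)
    show ?case
    proof (cases "t = s")
      case False
      then have t: "0 < t" "parent t \<in> S" using assms(3) less.prems by auto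
      moreover have "parent_rel (parent t) t"
        using t(1) less.prems assms(1) by (auto simp: parent_rel_def)
      ultimately have "(t, parent t) \<in> ?Q" "(parent t, s) \<in> ?Q\<^sup>*"
        using less parent_rel_less by (auto simp: symclp_def)
      then show ?thesis by (rule converse_rtrancl_into_rtrancl)
    qed simp
  qed
  have "(t, t') \<in> ?Q\<^sup>*" if "t \<in> S" "t' \<in> S" for t t'
    using root[OF that(1)] root[OF that(2)] sym by (meson rtrancl_trans symE)
  then show ?thesis
    using connected_iff_rtrancl[OF sym_graph_of, of S n parent_rel] assms(1,2) by auto
qed

text \<open>On a cycle, both neighbours of the largest vertex would be its parent.\<close>

lemma parent_rel_acyclic:
  assumes "distinct c" "successively (symclp parent_rel) c" "3 \<le> length c"
  shows "\<not> symclp parent_rel (last c) (hd c)"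
proof
  assume closing: "symclp parent_rel (last c) (hd c)"
  have "c \<noteq> []" using assms(3) by auto
  then obtain i where i: "i < length c" "c ! i = Max (set c)"
    by (metis Max_in List.finite_set in_set_conv_nth set_empty)
  \<comment> \<open>The cyclic neighbours of the position of the maximum; they differ because the
    cycle has at least three positions.\<close>
  define succ where "succ = (if Suc i = length c then 0 else Suc i)"
  define pred where "pred = (if i = 0 then length c - 1 else i - 1)"
  have ne: "succ < length c" "pred < length c" "succ \<noteq> i" "pred \<noteq> i" "succ \<noteq> pred"
    using i(1) assms(3) by (auto simp: succ_def pred_def)
  have closing': "symclp parent_rel (c ! (length c - 1)) (c ! 0)"
    using closing \<open>c \<noteq> []\<close> by (simp add: last_conv_nth hd_conv_nth)
  have step: "symclp parent_rel (c ! j) (c ! Suc j)" if "Suc j < length c" for j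
    using successively_nth[OF assms(2) that] .
  have "symclp parent_rel (c ! i) (c ! succ)"
  proof (cases "Suc i = length c")
    case True
    then have "i = length c - 1" by simp
    then show ?thesis using closing' True by (simp add: succ_def)
  qed (use step[of i] i(1) in \<open>simp add: succ_def\<close>)
  moreover have "symclp parent_rel (c ! pred) (c ! i)"
    using closing' step[of "i - 1"] i(1) by (cases i) (simp_all add: pred_def)
  moreover have "c ! j < c ! i" if "j < length c" "j \<noteq> i" for j
    using that i assms(1) Max_ge[of "set c" "c ! j"]
    by (metis List.finite_set nless_le nth_eq_iff_index_eq nth_mem)
  ultimately have "parent_rel (c ! succ) (c ! i)" "parent_rel (c ! pred) (c ! i)"
    using ne parent_rel_less less_asym unfolding symclp_def by metis+
  then have "c ! succ = c ! pred" by (simp add: parent_rel_def)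
  then show False using ne assms(1) by (simp add: nth_eq_iff_index_eq)
qed

text \<open>Makes the results on \<open>graph_of\<close> available for the tree itself; a single
  smaller neighbour is trivially a clique.\<close>

lemma elimination_graph_parent_rel: "elimination_graph 1 parent_rel n"
proof
  show "card {u. parent_rel u v} \<le> 1" for v
  proof -
    have "{u. parent_rel u v} \<subseteq> {parent v}" by (auto simp: parent_rel_def)
    then show ?thesis using card_mono[of "{parent v}"] by fastforce
  qed
qed (use pos in \<open>auto simp: parent_rel_less parent_rel_def\<close>)

lemma undirected_tree_parent: "undirected_tree (graph_of n parent_rel)"
proof -
  interpret P: elimination_graph 1 parent_rel n by (rule elimination_graph_parent_rel)
  have "Digraph_Component.connected (with_proj (graph_of n parent_rel) \<restriction> {..<n})"
  proof (rule connected_subtree)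
    show "0 < t \<and> parent t \<in> {..<n}" if "t \<in> {..<n}" "t \<noteq> 0" for t
      using that adj_parent bounded_fst by auto
  qed (use pos in auto)
  moreover have "pair_wf_digraph (graph_of n parent_rel)"
    using P.pair_graph_graph_of by (simp add: pair_graph_def pair_digraph_def pair_fin_digraph_def)
  ultimately have "Digraph_Component.connected (with_proj (graph_of n parent_rel))"
    using connected_restrict_pverts by fastforce
  then show ?thesis
    unfolding undirected_tree_def vpath_with_proj_iff
    using P.pair_graph_graph_of parent_rel_acyclic by auto
qed

text \<open>An edge lies in the bag of its larger end. The nodes whose bags contain \<open>u\<close>
  are \<open>u\<close> and its larger neighbours \<open>t\<close>; for these,
  \<open>parent t\<close> is \<open>u\<close> or a larger neighbour of \<open>u\<close>, so the
  nodes form a subtree with root \<open>u\<close>.\<close>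

lemma tree_decomposition_parent:
  "tree_decomposition (graph_of n A) (graph_of n parent_rel) (\<lambda>v. insert v {u. A u v})"
  unfolding tree_decomposition_def
proof (intro conjI undirected_tree_parent ballI)
  show "(\<Union>t\<in>pverts (graph_of n parent_rel). insert t {u. A u t}) = pverts (graph_of n A)"
    using bounded_fst by auto
next
  fix e assume "e \<in> parcs (graph_of n A)"
  then show "case e of (u, v) \<Rightarrow>
      \<exists>t\<in>pverts (graph_of n parent_rel). u \<in> insert t {u. A u t} \<and> v \<in> insert t {u. A u t}"
    using bounded by (cases e) (auto simp: symclp_def)
next
  fix u assume "u \<in> pverts (graph_of n A)"
  show "Digraph_Component.connected (with_proj (graph_of n parent_rel) \<restriction>
    {t \<in> pverts (graph_of n parent_rel). u \<in> insert t {u. A u t}})"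
  proof (rule connected_subtree[where s = u])
    fix t assume "t \<in> {t \<in> pverts (graph_of n parent_rel). u \<in> insert t {u. A u t}}" "t \<noteq> u"
    then have ut: "A u t" "t < n" by auto
    then have "0 < t" using less by fastforce
    moreover have p: "A (parent t) t" using \<open>0 < t\<close> ut(2) by (rule adj_parent)
    moreover have "u = parent t \<or> A u (parent t)"
      using le_parent[OF ut(1)] clique[OF ut(1) p] by fastforce
    ultimately show "0 < t \<and>
      parent t \<in> {t \<in> pverts (graph_of n parent_rel). u \<in> insert t {u. A u t}}"
      using bounded_fst by auto
  qed (use \<open>u \<in> pverts (graph_of n A)\<close> in auto)
qed

lemma decomposition_width_parent:
  "decomposition_width (graph_of n parent_rel) (\<lambda>v. insert v {u. A u v}) \<le> k"
proof -
  have "card (insert v {u. A u v}) \<le> Suc k" for v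
    using card_le[of v] finite_back[of v] by (simp add: card_insert_if)
  then have "(MAX t\<in>{..<n}. card (insert t {u. A u t})) \<le> Suc k"
    using pos by (intro Max.boundedI) auto
  then show ?thesis by (simp add: decomposition_width_def)
qed

text \<open>The clique bounds the width from below, the decomposition along parents from
  above.\<close>

lemma treewidth_eq:
  assumes "C \<subseteq> {..<n}" "card C = Suc k" "\<And>u v. u \<in> C \<Longrightarrow> v \<in> C \<Longrightarrow> u < v \<Longrightarrow> A u v"
  shows "treewidth (graph_of n A) = k"
proof (rule antisym)
  let ?W = "{decomposition_width T B | (T :: nat pair_pre_digraph) B.
    tree_decomposition (graph_of n A) T B}"
  have mem: "decomposition_width (graph_of n parent_rel) (\<lambda>v. insert v {u. A u v}) \<in> ?W"
    using tree_decomposition_parent by blast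
  then show "treewidth (graph_of n A) \<le> k"
    unfolding treewidth_def
    by (rule order_trans[OF cInf_lower decomposition_width_parent]) simp
  have "(u, v) \<in> parcs (graph_of n A)" if "u \<in> C" "v \<in> C" "u \<noteq> v" for u v
    using that assms(3) by (auto simp: symclp_def neq_iff)
  then have "k \<le> decomposition_width T B" if "tree_decomposition (graph_of n A) T B"
    for T :: "nat pair_pre_digraph" and B
    using decomposition_width_ge[OF that _ _ assms(2)] assms(1) by simp
  then show "k \<le> treewidth (graph_of n A)"
    unfolding treewidth_def using mem by (intro cInf_greatest) auto
qed

section \<open>The weak colouring number\<close>

lemma WReach_graph_of:
  assumes "v < n"
  shows "WReach r (graph_of n A) L v = wreach (symclp A) r L v"
  using WReach_eq_wreach[of "graph_of n A" v r L] pair_graph_graph_of assms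
  by (simp add: pair_graph_def pair_digraph_def pair_fin_digraph_def)

text \<open>The order \<open>id\<close> is the elimination order itself, for which descending walks
  account for all weakly reachable vertices.\<close>

lemma wcol_le: "wcol r (graph_of n A) \<le> (r + k) choose k"
proof -
  have "card (WReach r (graph_of n A) id v) \<le> (r + k) choose k" if "v < n" for v
  proof -
    have "card (wreach (symclp A) r id v) \<le> card (desc_reach A r v)"
      by (intro card_mono finite_desc_reach wreach_id_subset_desc_reach)
    also have "\<dots> \<le> (r + k) choose k"
      by (intro card_desc_reach_le elimination_order_axioms)
    finally show ?thesis using that by (simp add: WReach_graph_of)
  qed
  then have "(MAX v\<in>{..<n}. card (WReach r (graph_of n A) id v)) \<le> (r + k) choose k"
    using pos by (intro Max.boundedI) auto
  then show ?thesis
    unfolding wcol_def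
    by (intro cINF_lower2[where x = id]) (auto simp: linear_orders_def)
qed

lemma le_wcol:
  assumes "wcol_lower c r n A"
  shows "c \<le> wcol r (graph_of n A)"
  unfolding wcol_def
proof (rule cINF_greatest)
  show "linear_orders (graph_of n A) \<noteq> {}"
    by (auto simp: linear_orders_def intro: exI[of _ id])
  fix L assume "L \<in> linear_orders (graph_of n A)"
  then obtain v where v: "v < n" "c \<le> card (wreach (symclp A) r L v)"
    using assms unfolding wcol_lower_def linear_orders_def by auto
  then have "c \<le> card (WReach r (graph_of n A) L v)" by (simp add: WReach_graph_of)
  also have "\<dots> \<le> (MAX v\<in>pverts (graph_of n A). card (WReach r (graph_of n A) L v))"
    using v(1) by (intro Max_ge) auto
  finally show "c \<le> (MAX v\<in>pverts (graph_of n A). card (WReach r (graph_of n A) L v))" .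
qed

end

theorem theorem3:
  fixes k r :: nat
  assumes "k \<ge> 1" and "r \<ge> 1"
  shows "\<exists>G :: nat pair_pre_digraph. pair_graph G \<and> treewidth G = k \<and>
           wcol r G = (r + k) choose k \<and>
           (\<forall>r'. 1 \<le> r' \<and> r' \<le> r \<longrightarrow> wcol r' G = (r' + k) choose k)"
proof -
  \<comment> \<open>Since \<open>r\<close> is positive, the graph comes with the clique that forces
    treewidth at least \<open>k\<close>.\<close>
  obtain n A C where G: "elimination_graph k A n"
    and lower: "\<And>r'. r' \<le> r \<Longrightarrow> wcol_lower ((r' + k) choose k) r' n A"
    and C: "C \<subseteq> {..<n}" "card C = Suc k" "\<And>u v. u \<in> C \<Longrightarrow> v \<in> C \<Longrightarrow> u < v \<Longrightarrow> A u v"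
    using extremal_graph_exists[of k r] assms(2) by auto
  interpret elimination_graph k A n by fact
  have "wcol r' (graph_of n A) = (r' + k) choose k" if "r' \<le> r" for r'
    using wcol_le le_wcol[OF lower[OF that]] by (rule antisym)
  then show ?thesis
    using pair_graph_graph_of treewidth_eq[OF C] by (intro exI[of _ "graph_of n A"]) simp
qed

end
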